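(* Let $G$ be a countably infinite group and $G\curvearrowright X$ an action on a compact metrizable space by homeomorphisms. The following implications hold: (a) if $G\curvearrowright X$ has the pseudo-orbit tracing property, then it has the uniform strong TMP; (b) if $G\curvearrowright X$ has the uniform strong TMP, then it has the uniform TMP; (c) if $G\curvearrowright X$ has the uniform strong TMP, then it has the strong TMP; (d) if $G\curvearrowright X$ has the strong TMP, then it has the TMP; (e) if $G\curvearrowright X$ has the uniform TMP, then it has the TMP.
   Context: Fix a compatible metric $d$ on $X$ (the notions below do not depend on its choice). For $K\subset G$ and $x,y\in X$ write $d_K(x,y)=\sup_{g\in K}d(gx,gy)$. Pseudo-orbit tracing property (POTP): for every $\varepsilon>0$ there exist $\delta>0$ and a finite $S\subset G$ such that every $(S,\delta)$ pseudo-orbit, i.e. every family $\{x_g\}_{g\in G}$ in $X$ with $d(sx_g,x_{sg})<\delta$ for all $s\in S$, $g\in G$, is $\varepsilon$-traced by some $x\in X$, i.e. $d(gx,x_g)\le\varepsilon$ for all $g\in G$. Memory set: for $\varepsilon,\delta>0$ and finite $A\subset B\subset G$, $B$ is an $(\varepsilon,\delta)$-memory set for $A$ if for every $x,y\in X$ with $d_{B\setminus A}(x,y)\le\delta$ there is $z\in X$ with $d_B(x,z)\le\varepsilon$ and $d_{G\setminus A}(y,z)\le\varepsilon$. A set $V\subset G$ is $B$-separated if $Bv_1\cap Bv_2=\varnothing$ for all distinct $v_1,v_2\in V$. An $(\varepsilon,\delta)$-memory set $B$ for $A$ is uniform if for every finite $B$-separated $V\subset G$, all $x_v\in X$ ($v\in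 V$) and $y\in X$ with $d_{(B\setminus A)v}(x_v,y)\le\delta$ for every $v\in V$, there is $z\in X$ with $d_{Bv}(z,x_v)\le\varepsilon$ for every $v\in V$ and $d_{G\setminus AV}(z,y)\le\varepsilon$. TMP (resp. uniform TMP): for every $\varepsilon>0$ there is $\delta>0$ such that every finite $A\subset G$ admits an $(\varepsilon,\delta)$-memory set (resp. a uniform one). Strong TMP (resp. uniform strong TMP): for every $\varepsilon>0$ there exist $\delta>0$ and a finite $F\subset G$ containing the identity such that for every finite $A\subset G$ the set $FA$ is an $(\varepsilon,\delta)$-memory set (resp. a uniform one) for $A$. *)

theory Defs
  imports "HOL-Analysis.Analysis" "HOL-Algebra.Group_Action"
begin

text \<open>
  Throughout, \<open>G\<close> is a group acting by \<open>\<phi>\<close> on the set \<open>X\<close>, i.e. \<open>g x\<close> is \<open>\<phi> g x\<close>,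
  and \<open>d\<close> is a metric on \<open>X\<close>.
\<close>

text \<open>
  The supremum is taken in \<open>[0, \<infinity>)\<close>, so that it is \<open>0\<close> over the empty set; the supremum of
  the empty set of reals is not specified, hence the explicit \<open>0\<close>. The set is bounded whenever
  \<open>d\<close> is bounded, in particular if \<open>X\<close> is compact.
\<close>

definition dist_over :: "('g \<Rightarrow> 'x \<Rightarrow> 'x) \<Rightarrow> ('x \<Rightarrow> 'x \<Rightarrow> real) \<Rightarrow> 'g set \<Rightarrow> 'x \<Rightarrow> 'x \<Rightarrow> real" where
  "dist_over \<phi> d K x y = Sup (insert 0 ((\<lambda>g. d (\<phi> g x) (\<phi> g y)) ` K))"

definition pseudo_orbit ::
  "('g, 'b) monoid_scheme \<Rightarrow> ('g \<Rightarrow> 'x \<Rightarrow> 'x) \<Rightarrow> 'x set \<Rightarrow> ('x \<Rightarrow> 'x \<Rightarrow> real)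
    \<Rightarrow> 'g set \<Rightarrow> real \<Rightarrow> ('g \<Rightarrow> 'x) \<Rightarrow> bool" where
  "pseudo_orbit G \<phi> X d S \<delta> x \<longleftrightarrow>
     (\<forall>g\<in>carrier G. x g \<in> X) \<and>
     (\<forall>s\<in>S. \<forall>g\<in>carrier G. d (\<phi> s (x g)) (x (s \<otimes>\<^bsub>G\<^esub> g)) < \<delta>)"

definition traces ::
  "('g, 'b) monoid_scheme \<Rightarrow> ('g \<Rightarrow> 'x \<Rightarrow> 'x) \<Rightarrow> ('x \<Rightarrow> 'x \<Rightarrow> real)
    \<Rightarrow> real \<Rightarrow> 'x \<Rightarrow> ('g \<Rightarrow> 'x) \<Rightarrow> bool" where
  "traces G \<phi> d \<epsilon> z x \<longleftrightarrow> (\<forall>g\<in>carrier G. d (\<phi> g z) (x g) \<le> \<epsilon>)"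

definition POTP ::
  "('g, 'b) monoid_scheme \<Rightarrow> ('g \<Rightarrow> 'x \<Rightarrow> 'x) \<Rightarrow> 'x set \<Rightarrow> ('x \<Rightarrow> 'x \<Rightarrow> real) \<Rightarrow> bool" where
  "POTP G \<phi> X d \<longleftrightarrow>
     (\<forall>\<epsilon>>0. \<exists>\<delta>>0. \<exists>S. finite S \<and> S \<subseteq> carrier G \<and>
        (\<forall>x. pseudo_orbit G \<phi> X d S \<delta> x \<longrightarrow> (\<exists>z\<in>X. traces G \<phi> d \<epsilon> z x)))"

definition memory_set ::
  "('g, 'b) monoid_scheme \<Rightarrow> ('g \<Rightarrow> 'x \<Rightarrow> 'x) \<Rightarrow> 'x set \<Rightarrow> ('x \<Rightarrow> 'x \<Rightarrow> real)
    \<Rightarrow> real \<Rightarrow> real \<Rightarrow> 'g set \<Rightarrow> 'g set \<Rightarrow> bool" where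
  "memory_set G \<phi> X d \<epsilon> \<delta> A B \<longleftrightarrow>
     finite B \<and> A \<subseteq> B \<and> B \<subseteq> carrier G \<and>
     (\<forall>x\<in>X. \<forall>y\<in>X. dist_over \<phi> d (B - A) x y \<le> \<delta> \<longrightarrow>
        (\<exists>z\<in>X. dist_over \<phi> d B x z \<le> \<epsilon> \<and> dist_over \<phi> d (carrier G - A) y z \<le> \<epsilon>))"

definition separated :: "('g, 'b) monoid_scheme \<Rightarrow> 'g set \<Rightarrow> 'g set \<Rightarrow> bool" where
  "separated G B V \<longleftrightarrow>
     (\<forall>v\<in>V. \<forall>w\<in>V. v \<noteq> w \<longrightarrow> (B #>\<^bsub>G\<^esub> v) \<inter> (B #>\<^bsub>G\<^esub> w) = {})"

definition uniform_memory_set ::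
  "('g, 'b) monoid_scheme \<Rightarrow> ('g \<Rightarrow> 'x \<Rightarrow> 'x) \<Rightarrow> 'x set \<Rightarrow> ('x \<Rightarrow> 'x \<Rightarrow> real)
    \<Rightarrow> real \<Rightarrow> real \<Rightarrow> 'g set \<Rightarrow> 'g set \<Rightarrow> bool" where
  "uniform_memory_set G \<phi> X d \<epsilon> \<delta> A B \<longleftrightarrow>
     memory_set G \<phi> X d \<epsilon> \<delta> A B \<and>
     (\<forall>V x y. finite V \<and> V \<subseteq> carrier G \<and> separated G B V \<and> (\<forall>v\<in>V. x v \<in> X) \<and> y \<in> X \<and>
        (\<forall>v\<in>V. dist_over \<phi> d ((B - A) #>\<^bsub>G\<^esub> v) (x v) y \<le> \<delta>) \<longrightarrow>
        (\<exists>z\<in>X. (\<forall>v\<in>V. dist_over \<phi> d (B #>\<^bsub>G\<^esub> v) z (x v) \<le> \<epsilon>) \<and>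
           dist_over \<phi> d (carrier G - (A <#>\<^bsub>G\<^esub> V)) z y \<le> \<epsilon>))"

definition TMP ::
  "('g, 'b) monoid_scheme \<Rightarrow> ('g \<Rightarrow> 'x \<Rightarrow> 'x) \<Rightarrow> 'x set \<Rightarrow> ('x \<Rightarrow> 'x \<Rightarrow> real) \<Rightarrow> bool" where
  "TMP G \<phi> X d \<longleftrightarrow>
     (\<forall>\<epsilon>>0. \<exists>\<delta>>0. \<forall>A. finite A \<and> A \<subseteq> carrier G \<longrightarrow>
        (\<exists>B. memory_set G \<phi> X d \<epsilon> \<delta> A B))"

definition uniform_TMP ::
  "('g, 'b) monoid_scheme \<Rightarrow> ('g \<Rightarrow> 'x \<Rightarrow> 'x) \<Rightarrow> 'x set \<Rightarrow> ('x \<Rightarrow> 'x \<Rightarrow> real) \<Rightarrow> bool" where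
  "uniform_TMP G \<phi> X d \<longleftrightarrow>
     (\<forall>\<epsilon>>0. \<exists>\<delta>>0. \<forall>A. finite A \<and> A \<subseteq> carrier G \<longrightarrow>
        (\<exists>B. uniform_memory_set G \<phi> X d \<epsilon> \<delta> A B))"

definition strong_TMP ::
  "('g, 'b) monoid_scheme \<Rightarrow> ('g \<Rightarrow> 'x \<Rightarrow> 'x) \<Rightarrow> 'x set \<Rightarrow> ('x \<Rightarrow> 'x \<Rightarrow> real) \<Rightarrow> bool" where
  "strong_TMP G \<phi> X d \<longleftrightarrow>
     (\<forall>\<epsilon>>0. \<exists>\<delta>>0. \<exists>F. finite F \<and> F \<subseteq> carrier G \<and> \<one>\<^bsub>G\<^esub> \<in> F \<and>
        (\<forall>A. finite A \<and> A \<subseteq> carrier G \<longrightarrow> memory_set G \<phi> X d \<epsilon> \<delta> A (F <#>\<^bsub>G\<^esub> A)))"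

definition uniform_strong_TMP ::
  "('g, 'b) monoid_scheme \<Rightarrow> ('g \<Rightarrow> 'x \<Rightarrow> 'x) \<Rightarrow> 'x set \<Rightarrow> ('x \<Rightarrow> 'x \<Rightarrow> real) \<Rightarrow> bool" where
  "uniform_strong_TMP G \<phi> X d \<longleftrightarrow>
     (\<forall>\<epsilon>>0. \<exists>\<delta>>0. \<exists>F. finite F \<and> F \<subseteq> carrier G \<and> \<one>\<^bsub>G\<^esub> \<in> F \<and>
        (\<forall>A. finite A \<and> A \<subseteq> carrier G \<longrightarrow> uniform_memory_set G \<phi> X d \<epsilon> \<delta> A (F <#>\<^bsub>G\<^esub> A)))"

end

theory Submission
  imports Defs
begin

text \<open>
  For the implication from the POTP, take \<open>S\<close> and \<open>\<delta>\<^sub>0\<close> tracing \<open>\<epsilon>/2\<close>-closely and let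
  \<open>F = S \<union> S\<inverse> \<union> {1}\<close>. Given \<open>A\<close>, \<open>V\<close>, \<open>x\<^sub>v\<close> and \<open>y\<close>, splice orbits: put \<open>w g = g x\<^sub>v\<close> for
  \<open>g \<in> A v\<close> and \<open>w g = g y\<close> for \<open>g \<notin> A V\<close>. A step \<open>g \<mapsto> s g\<close> with \<open>s \<in> S\<close> can only enter or leave
  \<open>A v\<close> through \<open>(F A \<setminus> A) v\<close>, where the two orbits are \<open>\<delta>\<close>-close; a step leaving \<open>A v\<close> produces
  an error at most \<open>\<delta>\<close>, and a step entering it an error that is small by uniform continuity of
  \<open>s\<close>. Hence \<open>w\<close> is an \<open>(S, \<delta>\<^sub>0)\<close> pseudo-orbit and a point tracing it is the required one.
\<close>

section \<open>Orbit distances and uniform continuity\<close>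

text \<open>Finiteness of \<open>K\<close> bounds the set of distances, so \<open>Sup\<close> really
  dominates each of them.\<close>

lemma dist_overD:
  assumes "dist_over \<phi> d K x y \<le> c" and "finite K" and "g \<in> K"
  shows "d (\<phi> g x) (\<phi> g y) \<le> c"
proof -
  have "d (\<phi> g x) (\<phi> g y) \<le> dist_over \<phi> d K x y"
    unfolding dist_over_def using assms by (intro cSup_upper) auto
  then show ?thesis using assms by simp
qed

lemma dist_over_leI:
  assumes "0 \<le> c" and "\<And>g. g \<in> K \<Longrightarrow> d (\<phi> g x) (\<phi> g y) \<le> c"
  shows "dist_over \<phi> d K x y \<le> c"
  unfolding dist_over_def using assms by (intro cSup_least) auto

lemma dist_over_commute:
  assumes "\<And>u v. d u v = d v u"
  shows "dist_over \<phi> d K x y = dist_over \<phi> d K y x"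
  unfolding dist_over_def by (subst assms) simp

text \<open>By compactness each \<open>f s\<close> is uniformly continuous, and a finite family
  admits a common \<delta>. The premise \<open>d x y \<le> \<delta>\<close> is non-strict to match
  the bounds coming from \<open>dist_over\<close>.\<close>

lemma (in Metric_space) uniformly_continuous_finite_family:
  assumes "compact_space mtopology" and "finite S"
    and "\<And>s. s \<in> S \<Longrightarrow> continuous_map mtopology mtopology (f s)" and "0 < \<epsilon>"
  obtains \<delta> where "0 < \<delta>"
    and "\<And>s x y. s \<in> S \<Longrightarrow> x \<in> M \<Longrightarrow> y \<in> M \<Longrightarrow> d x y \<le> \<delta> \<Longrightarrow> d (f s x) (f s y) < \<epsilon>"
proof -
  have "\<exists>\<delta>>0. \<forall>s\<in>S. \<forall>x\<in>M. \<forall>y\<in>M. d x y \<le> \<delta> \<longrightarrow> d (f s x) (f s y) < \<epsilon>"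
    using assms(2,3)
  proof (induction S rule: finite_induct)
    case empty
    show ?case by (intro exI[of _ 1]) simp
  next
    case (insert s S)
    then obtain \<delta>1 where \<delta>1: "\<delta>1 > 0"
      "\<forall>s\<in>S. \<forall>x\<in>M. \<forall>y\<in>M. d x y \<le> \<delta>1 \<longrightarrow> d (f s x) (f s y) < \<epsilon>"
      by blast
    have "uniformly_continuous_map Self Self (f s)"
      using continuous_eq_uniformly_continuous_map[of Self Self "f s"] insert.prems assms(1)
      by (simp add: mtopology_of_def)
    then obtain \<delta>2 where \<delta>2: "\<delta>2 > 0"
      "\<forall>x\<in>M. \<forall>y\<in>M. d y x < \<delta>2 \<longrightarrow> d (f s y) (f s x) < \<epsilon>"
      unfolding uniformly_continuous_map_def using \<open>0 < \<epsilon>\<close> by fastforce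
    show ?case
      \<comment> \<open>Halving \<open>\<delta>2\<close> turns the strict bound of uniform
        continuity into a non-strict one.\<close>
      by (rule exI[of _ "min \<delta>1 (\<delta>2 / 2)"]) (use \<delta>1 \<delta>2 in \<open>auto simp: min_le_iff_disj\<close>)
  qed
  then show thesis using that by blast
qed

section \<open>Products and translates of subsets of the group\<close>

lemma mem_diff_r_coset:
  assumes "g \<in> B #>\<^bsub>G\<^esub> v" and "g \<notin> A #>\<^bsub>G\<^esub> v"
  shows "g \<in> (B - A) #>\<^bsub>G\<^esub> v"
  using assms unfolding r_coset_def by auto

lemma set_mult_eq_UN_r_coset: "A <#>\<^bsub>G\<^esub> V = (\<Union>v\<in>V. A #>\<^bsub>G\<^esub> v)"
  unfolding set_mult_def r_coset_def by auto

lemma (in monoid) subset_set_mult_left: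
  assumes "\<one> \<in> F" and "A \<subseteq> carrier G"
  shows "A \<subseteq> F <#> A"
proof
  fix a assume "a \<in> A"
  then have "a = \<one> \<otimes> a" using assms(2) by auto
  then show "a \<in> F <#> A" unfolding set_mult_def using assms(1) \<open>a \<in> A\<close> by blast
qed

lemma finite_set_mult:
  assumes "finite F" and "finite A"
  shows "finite (F <#>\<^bsub>G\<^esub> A)"
  unfolding set_mult_def using assms by auto

lemma (in monoid) mult_mem_set_mult_r_coset:
  assumes "f \<in> F" and "g \<in> A #> v" and "F \<subseteq> carrier G" "A \<subseteq> carrier G" "v \<in> carrier G"
  shows "f \<otimes> g \<in> (F <#> A) #> v"
proof -
  obtain a where a: "a \<in> A" "g = a \<otimes> v" using assms(2) unfolding r_coset_def by auto
  then have "f \<otimes> g = (f \<otimes> a) \<otimes> v" using assms by (auto simp: m_assoc subset_iff)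
  then show ?thesis unfolding r_coset_def set_mult_def using assms(1) a by blast
qed

lemma separated_unique:
  assumes "separated G B V" and "v \<in> V" "w \<in> V" and "g \<in> B #>\<^bsub>G\<^esub> v" "g \<in> B #>\<^bsub>G\<^esub> w"
  shows "v = w"
  using assms unfolding separated_def by blast

text \<open>Disjointness of the translates of \<open>B\<close> passes to those of the subset
  \<open>A\<close>, so an element of \<open>A <#> V\<close> determines its \<open>v\<close> and the
  definition by cases is unambiguous.\<close>

lemma splice_functions:
  assumes "A \<subseteq> B" and "separated G B V"
  obtains w where "\<And>v g. v \<in> V \<Longrightarrow> g \<in> A #>\<^bsub>G\<^esub> v \<Longrightarrow> w g = p v g"
    and "\<And>g. g \<notin> A <#>\<^bsub>G\<^esub> V \<Longrightarrow> w g = q g"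
proof -
  define w where "w g = (if g \<in> A <#>\<^bsub>G\<^esub> V then p (THE v. v \<in> V \<and> g \<in> A #>\<^bsub>G\<^esub> v) g else q g)" for g
  have "w g = p v g" if "v \<in> V" "g \<in> A #>\<^bsub>G\<^esub> v" for v g
  proof -
    have "(THE v. v \<in> V \<and> g \<in> A #>\<^bsub>G\<^esub> v) = v"
    proof (rule the_equality)
      fix u assume "u \<in> V \<and> g \<in> A #>\<^bsub>G\<^esub> u"
      then show "u = v"
        using assms that separated_unique[of G B V u v g] unfolding r_coset_def by blast
    qed (use that in blast)
    moreover have "g \<in> A <#>\<^bsub>G\<^esub> V" using that by (auto simp: set_mult_eq_UN_r_coset)
    ultimately show ?thesis by (simp add: w_def)
  qed
  moreover have "\<And>g. g \<notin> A <#>\<^bsub>G\<^esub> V \<Longrightarrow> w g = q g" by (simp add: w_def)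
  ultimately show thesis using that by blast
qed

section \<open>Gluing orbits by tracing a spliced pseudo-orbit\<close>

text \<open>This is the gluing clause of \<open>uniform_memory_set\<close> for
  \<open>F <#> A\<close>, with all constants as parameters, so that their choice can be made later
  and independently of \<open>A\<close>.\<close>

lemma tracing_imp_gluing:
  fixes G (structure)
  assumes "group_action G M \<phi>" and "Metric_space M d"
    and S: "S \<subseteq> carrier G"
    and F: "F \<subseteq> carrier G" "finite F" "\<one> \<in> F" "S \<subseteq> F" "m_inv G ` S \<subseteq> F"
    and \<delta>: "\<delta> < \<delta>0" "\<delta> \<le> \<epsilon> / 2" "0 < \<delta>"
    and uc: "\<And>s x y. s \<in> S \<Longrightarrow> x \<in> M \<Longrightarrow> y \<in> M \<Longrightarrow> d x y \<le> \<delta> \<Longrightarrow> d (\<phi> s x) (\<phi> s y) < \<delta>0"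
    and tr: "\<And>w. pseudo_orbit G \<phi> M d S \<delta>0 w \<Longrightarrow> \<exists>z\<in>M. traces G \<phi> d (\<epsilon> / 2) z w"
    and A: "finite A" "A \<subseteq> carrier G"
    and V: "V \<subseteq> carrier G" "separated G (F <#> A) V"
    and x: "\<And>v. v \<in> V \<Longrightarrow> x v \<in> M" and y: "y \<in> M"
    and close: "\<And>v. v \<in> V \<Longrightarrow> dist_over \<phi> d (((F <#> A) - A) #> v) (x v) y \<le> \<delta>"
  shows "\<exists>z\<in>M. (\<forall>v\<in>V. dist_over \<phi> d ((F <#> A) #> v) z (x v) \<le> \<epsilon>) \<and>
    dist_over \<phi> d (carrier G - (A <#> V)) z y \<le> \<epsilon>"
proof -
  interpret group_action G M \<phi> by fact
  interpret group G using group_hom by (rule group_hom.axioms)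
  interpret Metric_space M d by fact
  let ?B = "F <#> A"
  have AB: "A \<subseteq> ?B" using F(3) A(2) by (rule subset_set_mult_left)
  have finB: "finite ?B" using F(2) A(1) by (rule finite_set_mult)
  have Bc: "?B \<subseteq> carrier G" using F(1) A(2) by (rule set_mult_closed)
  have AvBv: "A #> v \<subseteq> ?B #> v" for v using AB unfolding r_coset_def by auto
  have closeD: "d (\<phi> g (x v)) (\<phi> g y) \<le> \<delta>" if "v \<in> V" "g \<in> ?B #> v" "g \<notin> A #> v" for v g
  proof (rule dist_overD[OF close[OF that(1)]])
    show "finite ((?B - A) #> v)" using finB unfolding r_coset_def by auto
    show "g \<in> (?B - A) #> v" using that(2,3) by (rule mem_diff_r_coset)
  qed
  \<comment> \<open>Such a \<open>g\<close> lies in no other \<open>A #> u\<close> either, because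
    \<open>?B #> u\<close> is disjoint from \<open>?B #> v\<close>. Hence \<open>w\<close> follows
    \<open>y\<close> on the whole collar of \<open>A #> v\<close>.\<close>
  have notin: "g \<notin> A <#> V" if "v \<in> V" "g \<in> ?B #> v" "g \<notin> A #> v" for v g
    using that AvBv separated_unique[OF V(2), of v] unfolding set_mult_eq_UN_r_coset by blast
  have act: "\<phi> g u \<in> M" if "g \<in> carrier G" "u \<in> M" for g u
    using element_image that by blast
  obtain w where w: "\<And>v g. v \<in> V \<Longrightarrow> g \<in> A #> v \<Longrightarrow> w g = \<phi> g (x v)"
      "\<And>g. g \<notin> A <#> V \<Longrightarrow> w g = \<phi> g y"
    using splice_functions[OF AB V(2), of "\<lambda>v g. \<phi> g (x v)" "\<lambda>g. \<phi> g y"] by blast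
  have "pseudo_orbit G \<phi> M d S \<delta>0 w"
    unfolding pseudo_orbit_def
  proof (intro conjI ballI)
    fix g assume g: "g \<in> carrier G"
    show "w g \<in> M"
    proof (cases "g \<in> A <#> V")
      case True
      then show ?thesis using w(1) act g x by (auto simp: set_mult_eq_UN_r_coset)
    qed (use w(2) act g y in auto)
  next
    fix s g assume s: "s \<in> S" and g: "g \<in> carrier G"
    have sc: "s \<in> carrier G" using s S by auto
    have comp: "\<phi> (s \<otimes> g) u = \<phi> s (\<phi> g u)" if "u \<in> M" for u
      using composition_rule that sc g by blast
    have sgc: "s \<otimes> g \<in> carrier G" using sc g by simp
    \<comment> \<open>The step from \<open>g\<close> to \<open>s \<otimes> g\<close> starts in a
      translate of \<open>A\<close>, enters one from outside, or avoids them all.\<close>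
    consider v where "v \<in> V" "g \<in> A #> v"
      | v where "v \<in> V" "g \<notin> A <#> V" "s \<otimes> g \<in> A #> v"
      | "g \<notin> A <#> V" "s \<otimes> g \<notin> A <#> V"
      unfolding set_mult_eq_UN_r_coset by blast
    then show "d (\<phi> s (w g)) (w (s \<otimes> g)) < \<delta>0"
    proof cases
      case (1 v)
      have sgB: "s \<otimes> g \<in> ?B #> v"
        using mult_mem_set_mult_r_coset[of s F g A v, OF subsetD[OF F(4) s] 1(2) F(1) A(2)] 1(1) V(1)
        by blast
      have wg: "\<phi> s (w g) = \<phi> (s \<otimes> g) (x v)" using w(1)[OF 1] comp x 1 by simp
      show ?thesis
      proof (cases "s \<otimes> g \<in> A #> v")
        case True
        then show ?thesis using w(1)[of v "s \<otimes> g"] wg 1 act sgc x \<delta> by simp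
      \<comment> \<open>The step leaves \<open>A #> v\<close> and lands in its collar, where
        closeness applies directly at \<open>s \<otimes> g\<close>.\<close>
      next
        case False
        then show ?thesis
          using w(2)[OF notin[OF 1(1) sgB]] wg closeD[OF 1(1) sgB] \<delta> by simp
      qed
    next
      case (2 v)
      \<comment> \<open>No closeness is assumed at \<open>s \<otimes> g\<close>, which lies in
        \<open>A #> v\<close>. The inverses in \<open>F\<close> place \<open>g\<close> in the collar
        instead, and \<open>uc\<close> carries the closeness at \<open>g\<close> over to
        \<open>s \<otimes> g\<close>.\<close>
      have "inv s \<otimes> (s \<otimes> g) = g" using sc g by (simp add: m_assoc[symmetric])
      then have gB: "g \<in> ?B #> v"
        using mult_mem_set_mult_r_coset[of "inv s" F "s \<otimes> g" A v, OF _ 2(3) F(1) A(2)]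
          s 2(1) F(5) V(1) by auto
      have gA: "g \<notin> A #> v" using 2 unfolding set_mult_eq_UN_r_coset by blast
      have "d (\<phi> g y) (\<phi> g (x v)) \<le> \<delta>" using closeD[OF 2(1) gB gA] by (simp add: commute)
      then have "d (\<phi> s (\<phi> g y)) (\<phi> s (\<phi> g (x v))) < \<delta>0"
        using uc s act g x 2 y by blast
      then show ?thesis using w(2)[OF 2(2)] w(1)[OF 2(1,3)] comp x 2 by simp
    next
      case 3
      then show ?thesis using w(2) comp[OF y] act[OF sgc y] \<delta> by simp
    qed
  qed
  then obtain z where z: "z \<in> M" "\<And>g. g \<in> carrier G \<Longrightarrow> d (\<phi> g z) (w g) \<le> \<epsilon> / 2"
    using tr unfolding traces_def by blast
  show ?thesis
  proof (intro bexI[of _ z] conjI ballI dist_over_leI)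
    fix v g assume v: "v \<in> V" and gB: "g \<in> ?B #> v"
    have g: "g \<in> carrier G" using gB Bc v V(1) r_coset_subset_G by blast
    show "d (\<phi> g z) (\<phi> g (x v)) \<le> \<epsilon>"
    proof (cases "g \<in> A #> v")
      case True
      then show ?thesis using z(2)[OF g] w(1)[OF v True] \<delta> by simp
    next
      case False
      \<comment> \<open>On the collar \<open>z\<close> traces the orbit of \<open>y\<close>, not
        that of \<open>x v\<close>; passing between them costs at most \<delta>, hence the split of
        \<epsilon> into halves.\<close>
      have "d (\<phi> g z) (\<phi> g y) \<le> \<epsilon> / 2"
        using z(2)[OF g] w(2)[OF notin[OF v gB False]] by simp
      moreover have "d (\<phi> g y) (\<phi> g (x v)) \<le> \<epsilon> / 2"
        using closeD[OF v gB False] \<delta> by (simp add: commute)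
      moreover have "d (\<phi> g z) (\<phi> g (x v)) \<le> d (\<phi> g z) (\<phi> g y) + d (\<phi> g y) (\<phi> g (x v))"
        using act g z(1) y x v by (intro triangle) auto
      ultimately show ?thesis by simp
    qed
  next
    fix g assume "g \<in> carrier G - (A <#> V)"
    then show "d (\<phi> g z) (\<phi> g y) \<le> \<epsilon>" using z(2)[of g] w(2)[of g] \<delta> by simp
  qed (use z \<delta> in auto)
qed

section \<open>From gluing to memory sets and the choice of constants\<close>

text \<open>The memory set condition is the case \<open>V = {1}\<close> of the gluing condition.\<close>

lemma uniform_memory_setI:
  fixes G (structure)
  assumes "group G" and sym: "\<And>u v. d u v = d v u"
    and B: "finite B" "A \<subseteq> B" "B \<subseteq> carrier G"
    and glue: "\<And>V x y. finite V \<Longrightarrow> V \<subseteq> carrier G \<Longrightarrow> separated G B V \<Longrightarrow> (\<And>v. v \<in> V \<Longrightarrow> x v \<in> M)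
      \<Longrightarrow> y \<in> M \<Longrightarrow> (\<And>v. v \<in> V \<Longrightarrow> dist_over \<phi> d ((B - A) #> v) (x v) y \<le> \<delta>)
      \<Longrightarrow> \<exists>z\<in>M. (\<forall>v\<in>V. dist_over \<phi> d (B #> v) z (x v) \<le> \<epsilon>) \<and>
        dist_over \<phi> d (carrier G - (A <#> V)) z y \<le> \<epsilon>"
  shows "uniform_memory_set G \<phi> M d \<epsilon> \<delta> A B"
proof -
  interpret group G by fact
  have "\<exists>z\<in>M. dist_over \<phi> d B x z \<le> \<epsilon> \<and> dist_over \<phi> d (carrier G - A) y z \<le> \<epsilon>"
    if "x \<in> M" "y \<in> M" "dist_over \<phi> d (B - A) x y \<le> \<delta>" for x y
  proof -
    have one: "C #> \<one> = C" if "C \<subseteq> B" for C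
      using that B(3) by (intro coset_mult_one) auto
    have "A <#> {\<one>} = A" using one[OF B(2)] by (simp add: r_coset_eq_set_mult)
    \<comment> \<open>Symmetry of \<open>d\<close> is needed because \<open>memory_set\<close> and
      the gluing clause put \<open>z\<close> in opposite arguments of
      \<open>dist_over\<close>.\<close>
    then show ?thesis
      using glue[of "{\<one>}" "\<lambda>_. x" y] that one[of B] one[of "B - A"]
      by (simp add: separated_def dist_over_commute[OF sym])
  qed
  then have "memory_set G \<phi> M d \<epsilon> \<delta> A B"
    unfolding memory_set_def using B by simp
  then show ?thesis
    unfolding uniform_memory_set_def by (auto intro!: glue)
qed

text \<open>Both \<delta> and \<open>F\<close> are built from \<epsilon> before any \<open>A\<close>
  is considered; this gives the strong form.\<close>

lemma POTP_imp_uniform_strong_TMP: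
  fixes G (structure)
  assumes "group_action G M \<phi>" and "Metric_space M d"
    and "compact_space (Metric_space.mtopology M d)"
    and cont: "\<And>g. g \<in> carrier G \<Longrightarrow>
      continuous_map (Metric_space.mtopology M d) (Metric_space.mtopology M d) (\<phi> g)"
    and "POTP G \<phi> M d"
  shows "uniform_strong_TMP G \<phi> M d"
  unfolding uniform_strong_TMP_def
proof (intro allI impI)
  interpret group_action G M \<phi> by fact
  interpret group G using group_hom by (rule group_hom.axioms)
  interpret Metric_space M d by fact
  fix \<epsilon> :: real assume "0 < \<epsilon>"
  then have "0 < \<epsilon> / 2" by simp
  then obtain \<delta>0 S where \<delta>0: "\<delta>0 > 0" and S: "finite S" "S \<subseteq> carrier G"
    and tr: "\<And>w. pseudo_orbit G \<phi> M d S \<delta>0 w \<Longrightarrow> \<exists>z\<in>M. traces G \<phi> d (\<epsilon> / 2) z w"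
    using \<open>POTP G \<phi> M d\<close>[unfolded POTP_def, rule_format, OF \<open>0 < \<epsilon> / 2\<close>] by metis
  obtain \<delta>1 where \<delta>1: "\<delta>1 > 0"
    "\<And>s x y. s \<in> S \<Longrightarrow> x \<in> M \<Longrightarrow> y \<in> M \<Longrightarrow> d x y \<le> \<delta>1 \<Longrightarrow> d (\<phi> s x) (\<phi> s y) < \<delta>0"
    using uniformly_continuous_finite_family[where f = \<phi>,
        OF assms(3) S(1) cont[OF subsetD[OF S(2)]] \<delta>0] by blast
  \<comment> \<open>The three bounds serve steps entering a translate, steps leaving one, and the
    final triangle inequality.\<close>
  define \<delta> where "\<delta> = min \<delta>1 (min (\<delta>0 / 2) (\<epsilon> / 2))"
  define F where "F = insert \<one> (S \<union> m_inv G ` S)"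
  have \<delta>: "\<delta> < \<delta>0" "\<delta> \<le> \<epsilon> / 2" "0 < \<delta>" "\<delta> \<le> \<delta>1"
    using \<delta>0 \<delta>1 \<open>0 < \<epsilon>\<close> unfolding \<delta>_def by auto
  have F: "F \<subseteq> carrier G" "finite F" "\<one> \<in> F" "S \<subseteq> F" "m_inv G ` S \<subseteq> F"
    using S unfolding F_def by auto
  have "uniform_memory_set G \<phi> M d \<epsilon> \<delta> A (F <#> A)" if A: "finite A" "A \<subseteq> carrier G" for A
  proof (rule uniform_memory_setI)
    show "finite (F <#> A)" using F(2) A(1) by (rule finite_set_mult)
    show "A \<subseteq> F <#> A" using F(3) A(2) by (rule subset_set_mult_left)
    show "F <#> A \<subseteq> carrier G" using F(1) A(2) by (rule set_mult_closed)
    show "\<exists>z\<in>M. (\<forall>v\<in>V. dist_over \<phi> d ((F <#> A) #> v) z (x v) \<le> \<epsilon>) \<and>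
        dist_over \<phi> d (carrier G - (A <#> V)) z y \<le> \<epsilon>"
      if "V \<subseteq> carrier G" "separated G (F <#> A) V" "\<And>v. v \<in> V \<Longrightarrow> x v \<in> M" "y \<in> M"
        "\<And>v. v \<in> V \<Longrightarrow> dist_over \<phi> d (((F <#> A) - A) #> v) (x v) y \<le> \<delta>" for V x y
    proof (rule tracing_imp_gluing[OF assms(1,2) S(2) F \<delta>(1-3) _ tr A that])
      show "d (\<phi> s a) (\<phi> s b) < \<delta>0" if "s \<in> S" "a \<in> M" "b \<in> M" "d a b \<le> \<delta>" for s a b
        using \<delta>1(2) that \<delta>(4) by (meson order_trans)
    qed
  qed (fact is_group commute)+
  then show "\<exists>\<delta>>0. \<exists>F. finite F \<and> F \<subseteq> carrier G \<and> \<one> \<in> F \<and>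
      (\<forall>A. finite A \<and> A \<subseteq> carrier G \<longrightarrow> uniform_memory_set G \<phi> M d \<epsilon> \<delta> A (F <#> A))"
    using \<delta>(3) F by blast
qed

theorem proposition3p10:
  fixes G :: "('g, 'b) monoid_scheme"
    and X :: "'x topology"
    and d :: "'x \<Rightarrow> 'x \<Rightarrow> real"
    and \<phi> :: "'g \<Rightarrow> 'x \<Rightarrow> 'x"
  assumes "group G" and "countable (carrier G)" and "infinite (carrier G)"
    and "compact_space X"
    and "Metric_space (topspace X) d" and "Metric_space.mtopology (topspace X) d = X"
    and "group_action G (topspace X) \<phi>"
    and "\<And>g. g \<in> carrier G \<Longrightarrow> homeomorphic_map X X (\<phi> g)"
  shows "(POTP G \<phi> (topspace X) d \<longrightarrow> uniform_strong_TMP G \<phi> (topspace X) d) \<and>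
         (uniform_strong_TMP G \<phi> (topspace X) d \<longrightarrow> uniform_TMP G \<phi> (topspace X) d) \<and>
         (uniform_strong_TMP G \<phi> (topspace X) d \<longrightarrow> strong_TMP G \<phi> (topspace X) d) \<and>
         (strong_TMP G \<phi> (topspace X) d \<longrightarrow> TMP G \<phi> (topspace X) d) \<and>
         (uniform_TMP G \<phi> (topspace X) d \<longrightarrow> TMP G \<phi> (topspace X) d)"
proof -
  have "POTP G \<phi> (topspace X) d \<longrightarrow> uniform_strong_TMP G \<phi> (topspace X) d"
  proof
    assume potp: "POTP G \<phi> (topspace X) d"
    show "uniform_strong_TMP G \<phi> (topspace X) d"
    \<comment> \<open>Unfolding replaces the metric topology by \<open>X\<close>, where compactness
      and continuity are given.\<close>
    proof (rule POTP_imp_uniform_strong_TMP[OF assms(7,5) _ _ potp], unfold assms(6))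
      show "compact_space X" by fact
      show "continuous_map X X (\<phi> g)" if "g \<in> carrier G" for g
        using assms(8)[OF that] by (rule homeomorphic_imp_continuous_map)
    qed
  qed
  \<comment> \<open>The remaining implications keep the same \<delta>: either \<open>F <#> A\<close>
    is the witness for \<open>B\<close>, or the uniform clause is dropped.\<close>
  moreover have "uniform_strong_TMP G \<phi> (topspace X) d \<longrightarrow> uniform_TMP G \<phi> (topspace X) d"
    unfolding uniform_strong_TMP_def uniform_TMP_def by meson
  moreover have "uniform_strong_TMP G \<phi> (topspace X) d \<longrightarrow> strong_TMP G \<phi> (topspace X) d"
    unfolding uniform_strong_TMP_def strong_TMP_def uniform_memory_set_def by meson
  moreover have "strong_TMP G \<phi> (topspace X) d \<longrightarrow> TMP G \<phi> (topspace X) d"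
    unfolding strong_TMP_def TMP_def by meson
  moreover have "uniform_TMP G \<phi> (topspace X) d \<longrightarrow> TMP G \<phi> (topspace X) d"
    unfolding uniform_TMP_def TMP_def uniform_memory_set_def by meson
  ultimately show ?thesis by blast
qed

end
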